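(* For any integer $s\geq 3$, $$CR(s,3)=\begin{cases}2\cdot 5^{\frac{s-3}{2}}+1 & \text{if } s \text{ is odd},\\ 5^{\frac{s-2}{2}}+1 & \text{if } s \text{ is even}.\end{cases}$$
   Context: An edge-colored $s$-vertex graph $G$ with edge-coloring $\chi$ is called orderable if there exist an ordering $(v_1,\ldots,v_s)$ of $V(G)$ and a list $(c_1,\ldots,c_{s-1})$ of not necessarily distinct colors such that for every edge $v_iv_j\in E(G)$ with $i<j$ we have $\chi(v_iv_j)=c_i$. An edge-colored graph is rainbow if all its edges have pairwise different colors. For positive integers $s,t$, $CR(s,t)$ is the minimum integer $n$ such that every edge-coloring of $K_n$ with any number of colors contains either an orderable copy of $K_s$ or a rainbow copy of $K_t$ (copies carry the inherited coloring). *)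

theory Defs
  imports Main "HOL-Library.Ramsey"
begin

text \<open>
  A graph is given by a vertex set \<open>V\<close> and a set \<open>E\<close> of two-element subsets of \<open>V\<close>; an
  edge-coloring is a function \<open>\<chi>\<close> on sets of which only the values on \<open>E\<close> matter. The complete
  graph on \<open>V\<close> has the edge set \<open>nsets V 2\<close>. Positions in lists are counted from 0.
\<close>

definition orderable :: "'a set \<Rightarrow> 'a set set \<Rightarrow> ('a set \<Rightarrow> 'c) \<Rightarrow> bool" where
  "orderable V E \<chi> \<longleftrightarrow>
     (\<exists>vs cs. set vs = V \<and> distinct vs \<and> length cs = length vs - 1 \<and>
        (\<forall>i j. i < j \<longrightarrow> j < length vs \<longrightarrow> {vs ! i, vs ! j} \<in> E \<longrightarrow>
           \<chi> {vs ! i, vs ! j} = cs ! i))"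

definition rainbow :: "'a set set \<Rightarrow> ('a set \<Rightarrow> 'c) \<Rightarrow> bool" where
  "rainbow E \<chi> \<longleftrightarrow> (\<forall>e\<in>E. \<forall>f\<in>E. e \<noteq> f \<longrightarrow> \<chi> e \<noteq> \<chi> f)"

text \<open>
  Colors are natural numbers: a finite complete graph has finitely many edges, so this puts no
  restriction on the number of colors.
\<close>

definition forces :: "nat \<Rightarrow> nat \<Rightarrow> nat \<Rightarrow> bool" where
  "forces s t n \<longleftrightarrow>
     (\<forall>\<chi> :: nat set \<Rightarrow> nat.
        (\<exists>S \<subseteq> {..<n}. card S = s \<and> orderable S (nsets S 2) \<chi>) \<or>
        (\<exists>T \<subseteq> {..<n}. card T = t \<and> rainbow (nsets T 2) \<chi>))"

text \<open>
  The value 0 marks the absence of a suitable \<open>n\<close>, since \<open>LEAST\<close> is unspecified then. For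
  \<open>s \<ge> 1\<close> and \<open>t \<ge> 1\<close> it cannot be a minimum, so a positive value of \<open>CR s t\<close> includes the
  claim that the minimum exists.
\<close>

definition CR :: "nat \<Rightarrow> nat \<Rightarrow> nat" where
  "CR s t = (if \<exists>n. forces s t n then LEAST n. forces s t n else 0)"

end

theory Submission
  imports Defs
begin

text \<open>
  Call a list ordered if each entry sends a single color to all later entries. A lexicographic
  product with the pentagon coloring of \<open>K\<^sub>5\<close> in two new colors multiplies the number of
  vertices by 5 and lengthens the longest ordered list by at most 2, which gives the lower bound.

  For the upper bound let \<open>g m\<close> be the claimed maximal number of vertices without an ordered list
  longer than \<open>m\<close>, and induct on \<open>m\<close>. If a vertex bipartition is crossed by one color only, each
  side has at most \<open>g (m - 1)\<close> vertices. Otherwise take a Gallai partition with colors \<open>r\<close>, \<open>b\<close>;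
  every vertex outside its part \<open>P\<close> lies in one of two monochromatic neighborhoods, of order at
  most \<open>g (m - 1)\<close> each, and an \<open>r\<close>-neighbor and a \<open>b\<close>-neighbor of \<open>P\<close> extend any ordered list
  of \<open>P\<close> by 2, so \<open>P\<close> has at most \<open>g (m - 2)\<close> vertices. For odd \<open>m\<close> these bounds add up to
  \<open>g m\<close>. For even \<open>m\<close> either some part attains length \<open>m - 2\<close>, and then its neighborhoods have at
  most \<open>2 g (m - 2)\<close> vertices, or all parts have at most \<open>g (m - 3)\<close> vertices, and 11 parts would
  contain an ordered list of 5 representatives whose last entry can be expanded inside its part.
\<close>

subsection \<open>Ordered lists\<close>

text \<open>One existential color per entry replaces the color list, so that prepending a vertex
  costs a single check. For the last entry the color condition is vacuous.\<close>

fun ord_list :: "('a \<Rightarrow> 'a \<Rightarrow> 'c) \<Rightarrow> 'a list \<Rightarrow> bool" where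
  "ord_list c [] \<longleftrightarrow> True"
| "ord_list c (v # vs) \<longleftrightarrow> v \<notin> set vs \<and> (\<exists>k. \<forall>u\<in>set vs. c v u = k) \<and> ord_list c vs"

definition ord_bound :: "('a \<Rightarrow> 'a \<Rightarrow> 'c) \<Rightarrow> 'a set \<Rightarrow> nat \<Rightarrow> bool" where
  "ord_bound c V m \<longleftrightarrow> (\<forall>vs. ord_list c vs \<longrightarrow> set vs \<subseteq> V \<longrightarrow> length vs \<le> m)"

definition rainbow_free :: "('a \<Rightarrow> 'a \<Rightarrow> 'c) \<Rightarrow> 'a set \<Rightarrow> bool" where
  "rainbow_free c V \<longleftrightarrow> (\<forall>x\<in>V. \<forall>y\<in>V. \<forall>z\<in>V. x \<noteq> y \<longrightarrow> y \<noteq> z \<longrightarrow> x \<noteq> z \<longrightarrow>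
     c x y = c x z \<or> c x y = c y z \<or> c x z = c y z)"

text \<open>The function \<open>g\<close> of the overview: \<open>5 ^ k\<close> at
  \<open>2 * k + 1\<close> and \<open>2 * 5 ^ k\<close> at \<open>2 * k + 2\<close>. The recursion
  starts at 3, since at 2 it would give 0.\<close>

fun max_order :: "nat \<Rightarrow> nat" where
  "max_order 0 = 0"
| "max_order (Suc 0) = 1"
| "max_order (Suc (Suc 0)) = 2"
| "max_order (Suc (Suc (Suc m))) = 5 * max_order (Suc m)"

lemma max_order_odd: "max_order (2 * k + 1) = 5 ^ k"
  by (induction k) auto

lemma max_order_even: "max_order (2 * k + 2) = 2 * 5 ^ k"
  by (induction k) auto

lemma max_order_pos: "m \<ge> 1 \<Longrightarrow> max_order m \<ge> 1"
  by (induction m rule: max_order.induct) auto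

lemma max_order_diff_2: "m \<ge> 3 \<Longrightarrow> max_order m = 5 * max_order (m - 2)"
  by (cases m rule: max_order.cases) auto

text \<open>Unlike \<open>max_order_diff_2\<close> this covers \<open>m = 2\<close>, where 0 stands
  against 2. It serves the parts bounded by \<open>m - 4\<close> when \<open>m = 4\<close>.\<close>

lemma max_order_diff_2_le: "m \<ge> 2 \<Longrightarrow> 5 * max_order (m - 2) \<le> max_order m"
  by (cases m rule: max_order.cases) auto

lemma max_order_pos_even: "even m \<Longrightarrow> m \<ge> 1 \<Longrightarrow> max_order m = 2 * max_order (m - 1)"
proof -
  assume m: "even m" "m \<ge> 1"
  define k where "k = m div 2 - 1"
  have k: "m = 2 * k + 2" using m unfolding k_def by presburger
  show ?thesis unfolding k using max_order_even[of k] max_order_odd[of k] by simp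
qed

lemma max_order_Suc_ge: "m \<ge> 1 \<Longrightarrow> 2 * max_order m \<le> max_order (Suc m)"
  by (induction m rule: max_order.induct) auto

lemma ord_list_iff_nth:
  "ord_list c vs \<longleftrightarrow> distinct vs \<and>
     (\<exists>g. \<forall>j<length vs. \<forall>i<j. c (vs ! i) (vs ! j) = g i)"
proof (induction vs)
  case Nil
  then show ?case by simp
next
  case (Cons v vs)
  have "(\<exists>k. \<forall>u\<in>set vs. c v u = k) \<and> (\<exists>g. \<forall>j<length vs. \<forall>i<j. c (vs ! i) (vs ! j) = g i)
    \<longleftrightarrow> (\<exists>g. \<forall>j<length (v # vs). \<forall>i<j. c ((v # vs) ! i) ((v # vs) ! j) = g i)"
    (is "?L \<longleftrightarrow> ?R")
  proof
    assume ?L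
    then obtain k g where k: "\<forall>u\<in>set vs. c v u = k"
      and g: "\<forall>j<length vs. \<forall>i<j. c (vs ! i) (vs ! j) = g i" by blast
    have "\<forall>j<length (v # vs). \<forall>i<j. c ((v # vs) ! i) ((v # vs) ! j) = case_nat k g i"
      using k g by (auto simp: nth_Cons' split: nat.split)
    then show ?R by blast
  next
    assume ?R
    then obtain g where g: "\<And>i j. j < length (v # vs) \<Longrightarrow> i < j \<Longrightarrow>
      c ((v # vs) ! i) ((v # vs) ! j) = g i" by blast
    have "\<forall>u\<in>set vs. c v u = g 0"
      using g[of "Suc _" 0] by (auto simp: in_set_conv_nth)
    moreover have "\<forall>j<length vs. \<forall>i<j. c (vs ! i) (vs ! j) = g (Suc i)"
      using g[of "Suc _" "Suc _"] by auto
    ultimately show ?L by (intro conjI exI)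
  qed
  then show ?case using Cons.IH by auto
qed

lemma ord_list_distinct: "ord_list c vs \<Longrightarrow> distinct vs"
  by (induction vs) auto

lemma ord_list_drop: "ord_list c vs \<Longrightarrow> ord_list c (drop n vs)"
  by (induction vs arbitrary: n) (auto simp: drop_Cons' dest: in_set_dropD)

text \<open>Only coincidences of colors at a common first vertex matter, and these survive any
  recoloring \<open>g\<close>.\<close>

lemma ord_list_map:
  assumes "ord_list c vs" and "inj_on h (set vs)"
    and "\<And>x y. x \<in> set vs \<Longrightarrow> y \<in> set vs \<Longrightarrow> x \<noteq> y \<Longrightarrow> d (h x) (h y) = g (c x y)"
  shows "ord_list d (map h vs)"
  using assms
proof (induction vs)
  case Nil
  then show ?case by simp
next
  case (Cons v vs)
  then obtain k where k: "\<forall>u\<in>set vs. c v u = k" by auto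
  have "\<forall>u\<in>set vs. d (h v) (h u) = g k"
    using Cons.prems(1) k Cons.prems(3)[of v] by (metis list.set_intros ord_list.simps(2))
  moreover have "h v \<notin> h ` set vs" using Cons.prems by auto
  moreover have "ord_list d (map h vs)" using Cons by auto
  ultimately show ?case by auto
qed

lemma ord_boundD: "ord_bound c V m \<Longrightarrow> ord_list c vs \<Longrightarrow> set vs \<subseteq> V \<Longrightarrow> length vs \<le> m"
  by (simp add: ord_bound_def)

lemma ord_bound_subset: "ord_bound c V m \<Longrightarrow> U \<subseteq> V \<Longrightarrow> ord_bound c U m"
  unfolding ord_bound_def by blast

lemma ord_bound_card: "finite V \<Longrightarrow> ord_bound c V (card V)"
  unfolding ord_bound_def by (metis card_mono distinct_card ord_list_distinct)

text \<open>An ordered list in \<open>U\<close> stays ordered with \<open>v\<close> put in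
  front.\<close>

lemma ord_bound_step:
  assumes "ord_bound c V m" "v \<in> V" "U \<subseteq> V" "v \<notin> U" "\<And>u. u \<in> U \<Longrightarrow> c v u = k"
  shows "ord_bound c U (m - 1)"
  unfolding ord_bound_def
proof (intro allI impI)
  fix vs assume vs: "ord_list c vs" "set vs \<subseteq> U"
  then have "\<forall>u\<in>set vs. c v u = k" using assms(5) by blast
  then have "ord_list c (v # vs)" using vs assms(4) by auto
  then have "length (v # vs) \<le> m" using assms(1,2,3) vs(2) by (intro ord_boundD) auto
  then show "length vs \<le> m - 1" by simp
qed

lemma rainbow_free_subset: "rainbow_free c V \<Longrightarrow> U \<subseteq> V \<Longrightarrow> rainbow_free c U"
  unfolding rainbow_free_def by blast

subsection \<open>Gallai partitions\<close>

text \<open>The parts are the fibers of \<open>f\<close> on \<open>V\<close>. For symmetric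
  \<open>c\<close>, varying only the first vertex within its part already makes each pair of parts
  monochromatic. The case \<open>r = b\<close> is allowed.\<close>

definition gallai_partition ::
  "('a \<Rightarrow> 'a \<Rightarrow> 'c) \<Rightarrow> 'a set \<Rightarrow> ('a \<Rightarrow> 'l) \<Rightarrow> 'c \<Rightarrow> 'c \<Rightarrow> bool" where
  "gallai_partition c V f r b \<longleftrightarrow> (\<exists>x\<in>V. \<exists>y\<in>V. f x \<noteq> f y) \<and>
     (\<forall>x\<in>V. \<forall>y\<in>V. f x \<noteq> f y \<longrightarrow> c x y = r \<or> c x y = b) \<and>
     (\<forall>x\<in>V. \<forall>x'\<in>V. \<forall>y\<in>V. f x = f x' \<longrightarrow> f x \<noteq> f y \<longrightarrow> c x y = c x' y)"

lemma gallai_partitionD: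
  assumes "gallai_partition c V f r b"
  shows gallai_partition_nontrivial: "\<exists>x\<in>V. \<exists>y\<in>V. f x \<noteq> f y"
    and gallai_partition_color: "\<And>x y. x \<in> V \<Longrightarrow> y \<in> V \<Longrightarrow> f x \<noteq> f y \<Longrightarrow> c x y = r \<or> c x y = b"
    and gallai_partition_uniform:
      "\<And>x x' y. x \<in> V \<Longrightarrow> x' \<in> V \<Longrightarrow> y \<in> V \<Longrightarrow> f x = f x' \<Longrightarrow> f x \<noteq> f y \<Longrightarrow> c x y = c x' y"
proof -
  note parts = assms[unfolded gallai_partition_def]
  show "\<exists>x\<in>V. \<exists>y\<in>V. f x \<noteq> f y" by (rule conjunct1[OF parts])
  show "c x y = r \<or> c x y = b" if "x \<in> V" "y \<in> V" "f x \<noteq> f y" for x y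
    using conjunct1[OF conjunct2[OF parts]] that by blast
  show "c x y = c x' y" if "x \<in> V" "x' \<in> V" "y \<in> V" "f x = f x'" "f x \<noteq> f y" for x x' y
    using conjunct2[OF conjunct2[OF parts]] that by blast
qed

text \<open>Handshake argument: an injective numbering \<open>e\<close> orients every edge, and
  \<open>E\<close> splits into the oriented edges and their reversals.\<close>

lemma even_card_symmetric:
  assumes "finite E" "sym E" "irrefl E"
  shows "even (card E)"
proof -
  obtain e :: "'a \<Rightarrow> nat" where e: "inj_on e (Field E)"
    using finite_imp_inj_to_nat_seg[OF finite_Field[OF assms(1)]] by blast
  define L where "L = {(x, y) \<in> E. e x < e y}"
  have "E = L \<union> L\<inverse>"
  proof
    show "E \<subseteq> L \<union> L\<inverse>"
    proof
      fix p assume "p \<in> E"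
      then obtain x y where p: "p = (x, y)" "(x, y) \<in> E" "(y, x) \<in> E" "x \<noteq> y"
        using assms(2,3) by (metis irrefl_def surj_pair symD)
      then have "x \<in> Field E" "y \<in> Field E" by (auto simp: Field_def)
      then have "e x \<noteq> e y" using e p(4) by (auto dest: inj_onD)
      then show "p \<in> L \<union> L\<inverse>" using p unfolding L_def by auto
    qed
  qed (use assms(2) in \<open>auto simp: L_def dest: symD\<close>)
  moreover have "L \<inter> L\<inverse> = {}" unfolding L_def by auto
  moreover have "finite L" using assms(1) unfolding L_def by (rule rev_finite_subset) auto
  ultimately have "card E = card L + card (L\<inverse>)" by (metis card_Un_disjoint finite_converse)
  then show ?thesis by (simp add: card_inverse)
qed

locale sym_coloring =
  fixes c :: "'a \<Rightarrow> 'a \<Rightarrow> 'c"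
  assumes sym: "c x y = c y x"
begin

lemma gallai_partition_swap: "gallai_partition c V f r b \<Longrightarrow> gallai_partition c V f b r"
  unfolding gallai_partition_def by blast

lemma rainbow_freeD:
  "rainbow_free c V \<Longrightarrow> x \<in> V \<Longrightarrow> y \<in> V \<Longrightarrow> z \<in> V \<Longrightarrow> x \<noteq> y \<Longrightarrow> y \<noteq> z \<Longrightarrow> x \<noteq> z \<Longrightarrow>
     c x y = c x z \<or> c x y = c y z \<or> c x z = c y z"
  unfolding rainbow_free_def by blast

text \<open>The parts are the connected components of the edges with colors other than \<open>r\<close> and \<open>b\<close>:
  moving along such an edge, the color towards a vertex of another part cannot change.\<close>

lemma gallai_partition_of_cut:
  assumes rf: "rainbow_free c V" and X: "X \<subseteq> V" "x0 \<in> X" "y0 \<in> V" "y0 \<notin> X"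
    and cut: "\<And>x y. x \<in> X \<Longrightarrow> y \<in> V - X \<Longrightarrow> c x y = r \<or> c x y = b"
  shows "\<exists>(f :: 'a \<Rightarrow> 'a set) r b. gallai_partition c V f r b"
proof -
  define R where "R = {(u, v). u \<in> V \<and> v \<in> V \<and> c u v \<noteq> r \<and> c u v \<noteq> b}"
  define f where "f v = R\<^sup>* `` {v}" for v
  have "sym R" unfolding R_def sym_def by (simp add: sym)
  then have symR: "sym (R\<^sup>*)" by (rule sym_rtrancl)
  have f_eq: "f x = f y \<longleftrightarrow> (x, y) \<in> R\<^sup>*" for x y
  proof
    assume "f x = f y"
    then show "(x, y) \<in> R\<^sup>*" unfolding f_def by blast
  next
    assume "(x, y) \<in> R\<^sup>*"
    then show "f x = f y" unfolding f_def using symR by (auto dest: symD intro: rtrancl_trans)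
  qed
  \<comment> \<open>No pair of \<open>R\<close> leaves \<open>X\<close>, so the component of
    \<open>x0\<close> misses \<open>y0\<close> and there are at least two parts.\<close>
  have "y \<in> X" if "(x0, y) \<in> R\<^sup>*" for y
    using that
  proof induction
    case base
    then show ?case using X by simp
  next
    case (step y z)
    then show ?case using cut[of y z] unfolding R_def by auto
  qed
  then have "f x0 \<noteq> f y0" using X f_eq by blast
  moreover have col: "c x y = r \<or> c x y = b" if "x \<in> V" "y \<in> V" "f x \<noteq> f y" for x y
    using that f_eq r_into_rtrancl[of "(x, y)" R] unfolding R_def by auto
  moreover have "c x y = c x' y"
    if "x \<in> V" "y \<in> V" "f x = f x'" "f x \<noteq> f y" for x x' y
  proof -
    have "(x, x') \<in> R\<^sup>*" using that f_eq by simp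
    then show ?thesis
    proof induction
      case base
      then show ?case by simp
    next
      case (step u v)
      have uv: "u \<in> V" "v \<in> V" "c u v \<noteq> r" "c u v \<noteq> b" using step(2) unfolding R_def by auto
      have "f u = f x" "f v = f x" using step(1,2) f_eq by (metis rtrancl.rtrancl_into_rtrancl)+
      then have neq: "u \<noteq> y" "v \<noteq> y" and "c u y = r \<or> c u y = b" "c v y = r \<or> c v y = b"
        using col uv that by auto
      moreover have "u = v \<or> c u v = c u y \<or> c u v = c v y \<or> c u y = c v y"
        using rainbow_freeD[OF rf, of u v y] uv that(2) neq by blast
      ultimately have "c u y = c v y" using uv(3,4) by auto
      then show ?case using step by simp
    qed
  qed
  ultimately have "gallai_partition c V f r b"
    unfolding gallai_partition_def using X
    by (intro conjI ballI impI) (blast, metis, metis)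
  then show ?thesis by blast
qed

lemma gallai_partition_of_vertex:
  assumes "rainbow_free c (insert x V)" "V \<noteq> {}" "x \<notin> V"
    and "\<And>y. y \<in> V \<Longrightarrow> c x y = r \<or> c x y = b"
  shows "\<exists>(f :: 'a \<Rightarrow> 'a set) r b. gallai_partition c (insert x V) f r b"
proof -
  obtain y where "y \<in> V" using assms(2) by blast
  then show ?thesis
    using assms by (intro gallai_partition_of_cut[where X = "{x}" and ?x0.0 = x and ?y0.0 = y and r = r and b = b]) auto
qed

text \<open>Add a vertex \<open>x\<close> to a partitioned coloring. Unless \<open>x\<close> is joined to some part in \<open>r\<close> and
  \<open>b\<close> only, it uses one further color, found towards every part, and at most one of \<open>r\<close>, \<open>b\<close>.\<close>

theorem ex_gallai_partition:
  assumes "finite V" "card V \<ge> 2" "rainbow_free c V"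
  shows "\<exists>(f :: 'a \<Rightarrow> 'a set) r b. gallai_partition c V f r b"
  using assms
proof (induction V rule: finite_induct)
  case empty
  then show ?case by simp
next
  case (insert x V)
  have rf: "rainbow_free c (insert x V)" by fact
  have ne: "V \<noteq> {}" using insert by auto
  show ?case
  proof (cases "card V \<ge> 2")
    case False
    then have "card V = 1" using insert by auto
    then obtain y where "V = {y}" by (auto simp: card_1_singleton_iff)
    then show ?thesis
      using rf insert by (intro gallai_partition_of_vertex[where r = "c x y" and b = "c x y"]) auto
  next
    case True
    then obtain f :: "'a \<Rightarrow> 'a set" and r b where part: "gallai_partition c V f r b"
      using insert.IH rainbow_free_subset[OF rf] by blast
    note ne2 = gallai_partition_nontrivial[OF part]
      and col = gallai_partition_color[OF part]
      and unif = gallai_partition_uniform[OF part]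
    define other where "other q \<longleftrightarrow> q \<in> V \<and> c x q \<noteq> r \<and> c x q \<noteq> b" for q
    have tri: "c x p = c x q \<or> c x p = c p q \<or> c x q = c p q" if "p \<in> V" "q \<in> V" "p \<noteq> q" for p q
      using rainbow_freeD[OF rf, of x p q] that insert by auto
    show ?thesis
    proof (cases "\<exists>p\<in>V. \<forall>q\<in>V. f q = f p \<longrightarrow> \<not> other q")
      case True
      then obtain p where p: "p \<in> V" "\<And>q. q \<in> V \<Longrightarrow> f q = f p \<Longrightarrow> c x q = r \<or> c x q = b"
        unfolding other_def by blast
      let ?X = "{q \<in> V. f q = f p}"
      show ?thesis
      proof (rule gallai_partition_of_cut[OF rf, where X = ?X and r = r and b = b])
        show "c u v = r \<or> c u v = b" if "u \<in> ?X" "v \<in> insert x V - ?X" for u v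
          using that p col[of u v] sym[of u v] by auto
      qed (use p insert in auto)
    next
      case False
      then have oth: "\<exists>q\<in>V. f q = f p \<and> other q" if "p \<in> V" for p using that by blast
      \<comment> \<open>The edge between \<open>p\<close> and \<open>q\<close> has color
        \<open>r\<close> or \<open>b\<close>, hence differs from both edges to \<open>x\<close>;
        these two must agree.\<close>
      have diff: "c x p = c x q" if "other p" "other q" "f p \<noteq> f q" for p q
        using tri[of p q] col[of p q] that unfolding other_def by metis
      \<comment> \<open>Within one part, compare both vertices with an \<open>other\<close> vertex
        of a second part.\<close>
      have same: "c x p = c x q" if "other p" "other q" for p q
      proof (cases "f p = f q")
        case True
        obtain t where "t \<in> V" "f t \<noteq> f p" using ne2 by metis
        then obtain s where "other s" "f s \<noteq> f p" using oth by metis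
        then show ?thesis using diff that True by metis
      qed (use diff that in blast)
      obtain p0 where p0: "other p0" using ne oth by blast
      \<comment> \<open>Here \<open>c x p\<close> differs from the other two edges of the triangle,
        so those share their color.\<close>
      have toward: "c q p = c x q" if "q \<in> V" "\<not> other q" "other p" "f p \<noteq> f q" for p q
        using tri[of p q] col[of p q] that sym[of p q] unfolding other_def by metis
      have "c x q = c x q'" if q: "q \<in> V" "\<not> other q" "q' \<in> V" "\<not> other q'" for q q'
      proof (cases "f q = f q'")
        case True
        obtain t where "t \<in> V" "f t \<noteq> f q" using ne2 by metis
        then obtain p where "other p" "f p \<noteq> f q" "p \<in> V" using oth by metis
        then show ?thesis using toward[of q p] toward[of q' p] unif[of q q' p] q True by metis
      next
        case False
        \<comment> \<open>Both \<open>c x q\<close> and \<open>c x q'\<close> turn out to be the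
          single color between the parts of \<open>q\<close> and \<open>q'\<close>.\<close>
        obtain p p' where p: "other p" "f p = f q'" "p \<in> V" "other p'" "f p' = f q" "p' \<in> V"
          using oth q by metis
        have "c x q = c q p" using toward p q False by metis
        also have "\<dots> = c p' p" using unif p q False by metis
        also have "\<dots> = c p p'" by (rule sym)
        also have "\<dots> = c q' p'" using unif p q False by metis
        also have "\<dots> = c x q'" using toward p q False by metis
        finally show ?thesis .
      qed
      then obtain k where "\<And>q. q \<in> V \<Longrightarrow> \<not> other q \<Longrightarrow> c x q = k" by metis
      then show ?thesis
        using ne insert same p0
        by (intro gallai_partition_of_vertex[OF rf, where r = "c x p0" and b = k]) blast+
    qed
  qed
qed

subsection \<open>Two-colored complete graphs on 11 vertices\<close>

lemma mono_half:
  assumes "finite U" "v \<notin> U" "card U \<ge> 2 * n + 1" "\<And>u. u \<in> U \<Longrightarrow> c v u = r \<or> c v u = b"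
  shows "\<exists>W\<subseteq>U. \<exists>k. card W \<ge> Suc n \<and> (\<forall>u\<in>W. c v u = k)"
proof -
  let ?R = "{u \<in> U. c v u = r}" and ?B = "{u \<in> U. c v u = b}"
  have "U = ?R \<union> ?B" using assms(4) by blast
  then have "card U \<le> card ?R + card ?B" by (metis card_Un_le)
  then have "card ?R \<ge> Suc n \<or> card ?B \<ge> Suc n" using assms(3) by linarith
  then show ?thesis
  proof
    assume "card ?R \<ge> Suc n"
    then show ?thesis by (intro exI[of _ ?R] conjI exI[of _ r]) auto
  next
    assume "card ?B \<ge> Suc n"
    then show ?thesis by (intro exI[of _ ?B] conjI exI[of _ b]) auto
  qed
qed

text \<open>Not all vertices can have five neighbors in each color, because \<open>11 \<cdot> 5\<close> is odd.\<close>

lemma two_colored_11_vertices: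
  assumes T: "finite T" "card T = 11"
    and col: "\<And>x y. x \<in> T \<Longrightarrow> y \<in> T \<Longrightarrow> x \<noteq> y \<Longrightarrow> c x y = r \<or> c x y = b"
  shows "\<exists>v\<in>T. \<exists>X\<subseteq>T - {v}. \<exists>k. card X \<ge> 6 \<and> (\<forall>u\<in>X. c v u = k)"
proof (rule ccontr)
  assume contra: "\<not> ?thesis"
  let ?N = "\<lambda>k v. {u \<in> T. u \<noteq> v \<and> c v u = k}"
  have "card (?N r v) = 5" if v: "v \<in> T" for v
  proof -
    have le: "card (?N k v) \<le> 5" for k
    proof (rule ccontr)
      assume "\<not> card (?N k v) \<le> 5"
      then have "card (?N k v) \<ge> 6" by simp
      moreover have "?N k v \<subseteq> T - {v}" "\<forall>u\<in>?N k v. c v u = k" by blast+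
      ultimately show False using contra v by meson
    qed
    have "T - {v} = ?N r v \<union> ?N b v" using col v by blast
    then have "card (T - {v}) \<le> card (?N r v) + card (?N b v)" by (simp only: card_Un_le)
    then show ?thesis using le[of r] le[of b] T v by simp
  qed
  then have "card (SIGMA v:T. ?N r v) = 55" using T by simp
  moreover have "even (card (SIGMA v:T. ?N r v))"
    using T by (intro even_card_symmetric) (auto simp: sym_def irrefl_def sym)
  ultimately show False by simp
qed

text \<open>Passing to monochromatic neighborhoods leaves first 6 and then 3 vertices, and in a
  two-colored triangle some vertex sends one color to the other two.\<close>

lemma two_colored_ord_list_5:
  assumes T: "finite T" "card T = 11"
    and col: "\<And>x y. x \<in> T \<Longrightarrow> y \<in> T \<Longrightarrow> x \<noteq> y \<Longrightarrow> c x y = r \<or> c x y = b"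
  shows "\<exists>v1 v2 v3 v4 v5. {v1, v2, v3, v4, v5} \<subseteq> T \<and> ord_list c [v1, v2, v3, v4, v5]"
proof -
  obtain v1 X k1 where X: "v1 \<in> T" "X \<subseteq> T - {v1}" "card X \<ge> 6" "\<forall>u\<in>X. c v1 u = k1"
    using two_colored_11_vertices[OF T col] by blast
  have finX: "finite X" using X(3) by (metis card.infinite not_numeral_le_zero)
  obtain v2 where v2: "v2 \<in> X" using X(3) by fastforce
  have "card (X - {v2}) \<ge> 2 * 2 + 1" using v2 X(3) finX by simp
  then obtain Y k2 where Y: "Y \<subseteq> X - {v2}" "card Y \<ge> Suc 2" "\<forall>u\<in>Y. c v2 u = k2"
    using mono_half[of "X - {v2}" v2 2 r b] col finX v2 X by blast
  obtain Z where "Z \<subseteq> Y" "card Z = 3" using Y(2) obtain_subset_with_card_n[of 3 Y] by auto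
  then obtain x y z where Z: "{x, y, z} \<subseteq> Y" "x \<noteq> y" "y \<noteq> z" "x \<noteq> z"
    by (metis card_3_iff)
  have "\<exists>v3 v4 v5. {v3, v4, v5} \<subseteq> Y \<and> ord_list c [v3, v4, v5]"
  proof -
    have "x \<in> T" "y \<in> T" "z \<in> T" using Z Y X by auto
    then have "c x y = c x z \<or> c x y = c y z \<or> c x z = c y z" using col Z by metis
    then have "ord_list c [x, y, z] \<or> ord_list c [y, x, z] \<or> ord_list c [z, x, y]"
      using Z by (auto simp: sym)
    then show ?thesis using Z by blast
  qed
  then obtain v3 v4 v5 where v: "{v3, v4, v5} \<subseteq> Y" "ord_list c [v3, v4, v5]" by blast
  have "ord_list c [v1, v2, v3, v4, v5]" using v X Y v2 by auto
  moreover have "{v1, v2, v3, v4, v5} \<subseteq> T" using v X Y v2 by auto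
  ultimately show ?thesis by blast
qed

end

subsection \<open>The upper bound\<close>

text \<open>The induction step when no cut of \<open>V\<close> is monochromatic, which is why every
  part has neighbors in both colors. \<open>card_le\<close> is the induction hypothesis.\<close>

locale gallai_parts = sym_coloring c for c :: "'a \<Rightarrow> 'a \<Rightarrow> 'c" +
  fixes V :: "'a set" and f :: "'a \<Rightarrow> 'l" and r b :: 'c and m :: nat
  assumes fin: "finite V"
    and gallai: "gallai_partition c V f r b"
    and r_neighbor: "v \<in> V \<Longrightarrow> \<exists>u\<in>V. f u \<noteq> f v \<and> c v u = r"
    and b_neighbor: "v \<in> V \<Longrightarrow> \<exists>u\<in>V. f u \<noteq> f v \<and> c v u = b"
    and r_neq_b: "r \<noteq> b"
    and bound: "ord_bound c V m"
    and card_le: "k < m \<Longrightarrow> U \<subseteq> V \<Longrightarrow> ord_bound c U k \<Longrightarrow> card U \<le> max_order k"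
begin

abbreviation part :: "'a \<Rightarrow> 'a set" where
  "part v \<equiv> {u \<in> V. f u = f v}"

abbreviation nb :: "'c \<Rightarrow> 'a \<Rightarrow> 'a set" where
  "nb k v \<equiv> {u \<in> V. f u \<noteq> f v \<and> c v u = k}"

lemma swap_colors: "gallai_parts c V f b r m"
  by (intro gallai_parts.intro sym_coloring_axioms gallai_parts_axioms.intro fin
    gallai_partition_swap[OF gallai] b_neighbor r_neighbor r_neq_b[symmetric] bound card_le)

lemma cross_color: "x \<in> V \<Longrightarrow> y \<in> V \<Longrightarrow> f x \<noteq> f y \<Longrightarrow> c x y = r \<or> c x y = b"
  by (rule gallai_partition_color[OF gallai])

lemma cross_uniform:
  "x \<in> V \<Longrightarrow> x' \<in> V \<Longrightarrow> y \<in> V \<Longrightarrow> f x = f x' \<Longrightarrow> f x \<noteq> f y \<Longrightarrow> c x y = c x' y"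
  by (rule gallai_partition_uniform[OF gallai])

lemma cross_uniform_right:
  "x \<in> V \<Longrightarrow> x' \<in> V \<Longrightarrow> y \<in> V \<Longrightarrow> f x = f x' \<Longrightarrow> f x \<noteq> f y \<Longrightarrow> c y x = c y x'"
  using cross_uniform sym by metis

text \<open>All vertices of \<open>part v\<close> look alike from outside, so \<open>v\<close> can
  be expanded to any ordered list inside its part.\<close>

lemma ord_list_append_part:
  assumes "ord_list c (xs @ [v])" "set xs \<subseteq> V" "v \<in> V" "\<And>x. x \<in> set xs \<Longrightarrow> f x \<noteq> f v"
    and "ord_list c ws" "set ws \<subseteq> part v"
  shows "ord_list c (xs @ ws)"
  using assms
proof (induction xs)
  case Nil
  then show ?case by simp
next
  case (Cons x xs)
  have "x \<in> V" "f x \<noteq> f v" using Cons.prems by auto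
  then have "c x w = c x v" if "w \<in> set ws" for w
    using that Cons.prems(3,6) cross_uniform_right[of w v x] by auto
  moreover have "x \<notin> set ws" using Cons.prems(4,6) by auto
  moreover have "ord_list c (xs @ ws)" using Cons by auto
  moreover obtain k where "\<forall>u\<in>set (xs @ [v]). c x u = k" using Cons.prems(1) by auto
  ultimately show ?case using Cons.prems(1) by auto
qed

lemma part_bound_append:
  assumes "ord_list c (xs @ [v])" "set xs \<subseteq> V" "v \<in> V" "\<And>x. x \<in> set xs \<Longrightarrow> f x \<noteq> f v"
  shows "ord_bound c (part v) (m - length xs)"
  unfolding ord_bound_def
proof (intro allI impI)
  fix ws assume ws: "ord_list c ws" "set ws \<subseteq> part v"
  have "ord_list c (xs @ ws)" by (rule ord_list_append_part[OF assms ws])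
  then have "length (xs @ ws) \<le> m" using ws(2) assms(2) by (intro ord_boundD[OF bound]) auto
  then show "length ws \<le> m - length xs" by simp
qed

lemma f_neq_if_colors:
  assumes "v \<in> V" "x \<in> nb r v" "y \<in> nb b v"
  shows "f x \<noteq> f y"
  using assms cross_uniform_right[of x y v] r_neq_b by auto

text \<open>The color between an \<open>r\<close>-neighbor \<open>x\<close> and a
  \<open>b\<close>-neighbor \<open>y\<close> is also the color that one of them sends to
  \<open>v\<close>; that one goes first.\<close>

lemma part_bound:
  assumes v: "v \<in> V"
  shows "ord_bound c (part v) (m - 2)"
proof -
  obtain x y where x: "x \<in> nb r v" and y: "y \<in> nb b v"
    using r_neighbor[OF v] b_neighbor[OF v] by blast
  have neq: "f x \<noteq> f y" using f_neq_if_colors v x y by blast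
  then consider "c x y = r" | "c y x = b" using cross_color[of x y] x y sym[of x y] by auto
  then show ?thesis
  proof cases
    case 1
    then have "ord_list c ([x, y] @ [v])" using x y neq sym[of v] by auto
    then show ?thesis using part_bound_append[of "[x, y]" v] x y v by (simp add: numeral_2_eq_2) blast
  next
    case 2
    then have "ord_list c ([y, x] @ [v])" using x y neq sym[of v] by auto
    then show ?thesis using part_bound_append[of "[y, x]" v] x y v by (simp add: numeral_2_eq_2) blast
  qed
qed

lemma nb_bound: "v \<in> V \<Longrightarrow> ord_bound c (nb k v) (m - 1)"
  by (rule ord_bound_step[OF bound, where v = v and k = k]) auto

text \<open>Parts are nonempty, so \<open>m - 2\<close> is positive. Hence subtracting up to 3 from
  \<open>m\<close> is exact.\<close>

lemma m_ge_3: "m \<ge> 3"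
proof -
  obtain v where v: "v \<in> V" using gallai_partition_nontrivial[OF gallai] by blast
  have "ord_list c [v]" by simp
  then have "length [v] \<le> m - 2" using v by (intro ord_boundD[OF part_bound[OF v]]) auto
  then show ?thesis by simp
qed

lemma card_split:
  assumes v: "v \<in> V"
  shows "card V \<le> card (part v) + card (nb r v) + card (nb b v)"
proof -
  have "V = part v \<union> nb r v \<union> nb b v" using cross_color[OF v] by force
  then have "card V = card (part v \<union> nb r v \<union> nb b v)" by (rule arg_cong)
  also have "\<dots> \<le> card (part v \<union> nb r v) + card (nb b v)" by (rule card_Un_le)
  also have "card (part v \<union> nb r v) \<le> card (part v) + card (nb r v)" by (rule card_Un_le)
  finally show ?thesis by simp
qed

lemma card_le_odd:
  assumes "odd m"
  shows "card V \<le> max_order m"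
proof -
  obtain v where v: "v \<in> V" using gallai_partition_nontrivial[OF gallai] by blast
  have "card (part v) \<le> max_order (m - 2)"
    using m_ge_3 by (intro card_le part_bound v) auto
  moreover have nb: "card (nb k v) \<le> max_order (m - 1)" for k
    using m_ge_3 by (intro card_le nb_bound v) auto
  ultimately have "card V \<le> max_order (m - 2) + 2 * max_order (m - 1)"
    using card_split[OF v] nb[of r] nb[of b] by linarith
  \<comment> \<open>As \<open>m - 1\<close> is even, each neighborhood contributes
    \<open>2 * max_order (m - 2)\<close>, and 1 + 2 + 2 = 5.\<close>
  also have "max_order (m - 1) = 2 * max_order (m - 1 - 1)"
    using m_ge_3 assms by (intro max_order_pos_even) simp_all
  also have "m - 1 - 1 = m - 2" by simp
  also have "max_order (m - 2) + 2 * (2 * max_order (m - 2)) = 5 * max_order (m - 2)" by simp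
  also have "\<dots> = max_order m"
    using max_order_diff_2 m_ge_3 by simp
  finally show ?thesis .
qed

text \<open>An \<open>r\<close>-colored edge among the \<open>r\<close>-neighbors would, together with any \<open>b\<close>-neighbor, put three
  vertices in front of the part.\<close>

lemma nb_no_edge:
  assumes v: "v \<in> V" and large: "\<not> ord_bound c (part v) (m - 3)"
    and u: "u1 \<in> nb r v" "u2 \<in> nb r v" "u1 \<noteq> u2"
  shows "c u1 u2 \<noteq> r"
proof
  assume e: "c u1 u2 = r"
  obtain w where w: "w \<in> nb b v" using b_neighbor[OF v] by blast
  have neq: "f u1 \<noteq> f w" "f u2 \<noteq> f w" using f_neq_if_colors v u w by blast+
  have no: "\<not> ord_list c [x, y, z, v]" if "{x, y, z} = {u1, u2, w}" for x y z
  proof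
    assume "ord_list c [x, y, z, v]"
    moreover have "{u1, u2, w} \<subseteq> {y \<in> V. f y \<noteq> f v}" using u w by blast
    then have "set [x, y, z] \<subseteq> {y \<in> V. f y \<noteq> f v}" using that by simp
    ultimately have "ord_bound c (part v) (m - length [x, y, z])"
      using v by (intro part_bound_append) (simp, blast+)
    then show False using large by (simp add: numeral_3_eq_3)
  qed
  have "c u1 v = r" "c u2 v = r" "c w v = b" "c u2 u1 = r" "u1 \<noteq> v" "u2 \<noteq> v" "w \<noteq> v"
    using u w e sym by auto
  moreover have "c u1 w = r \<or> c u1 w = b" "c u2 w = r \<or> c u2 w = b"
    using cross_color neq u w by auto
  moreover have "c w u1 = c u1 w" "c w u2 = c u2 w" by (rule sym)+
  moreover have "w \<noteq> u1" "w \<noteq> u2" using neq by blast+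
  \<comment> \<open>Place \<open>w\<close> after those of \<open>u1\<close>, \<open>u2\<close> that
    are joined to it in \<open>r\<close> and before those joined to it in \<open>b\<close>.\<close>
  ultimately have "ord_list c [w, u1, u2, v] \<or> ord_list c [u1, u2, w, v] \<or>
      ord_list c [u1, w, u2, v] \<or> ord_list c [u2, w, u1, v]"
    using e u(3) by (elim disjE) simp_all
  moreover have "{w, u1, u2} = {u1, u2, w}" "{u1, w, u2} = {u1, u2, w}" "{u2, w, u1} = {u1, u2, w}"
    by blast+
  ultimately show False using no by metis
qed

text \<open>Fix an \<open>r\<close>-neighbor \<open>p\<close>. Outside \<open>part p\<close> the
  neighborhood is joined to \<open>p\<close> in \<open>b\<close> only, so \<open>v\<close> and
  \<open>p\<close> can both precede any ordered list there.\<close>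

lemma card_nb_le_large_part:
  assumes v: "v \<in> V" and large: "\<not> ord_bound c (part v) (m - 3)"
  shows "card (nb r v) \<le> 2 * max_order (m - 2)"
proof -
  obtain p where p: "p \<in> nb r v" using r_neighbor[OF v] by blast
  let ?U = "nb r v - part p"
  have "ord_bound c ?U (m - 1 - 1)"
  proof (rule ord_bound_step[OF nb_bound[OF v] p])
    show "c p u = b" if u: "u \<in> ?U" for u
    proof -
      have "f p \<noteq> f u" using u by auto
      then have "p \<noteq> u" "c p u = r \<or> c p u = b" using cross_color[of p u] p u by auto
      then show ?thesis using nb_no_edge[OF v large p, of u] u by blast
    qed
  qed (use p in auto)
  then have "card ?U \<le> max_order (m - 2)"
    using m_ge_3 by (intro card_le) (auto simp: numeral_eq_Suc)
  moreover have "card (part p) \<le> max_order (m - 2)"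
    using m_ge_3 p by (intro card_le part_bound) auto
  moreover have "card (nb r v) \<le> card (part p \<union> ?U)"
    using fin by (intro card_mono) auto
  moreover have "card (part p \<union> ?U) \<le> card (part p) + card ?U" by (rule card_Un_le)
  ultimately show ?thesis by linarith
qed

text \<open>Outside \<open>part p\<close>, sort by the color towards \<open>p\<close>;
  \<open>v\<close> and \<open>p\<close> precede ordered lists of either class. The term
  \<open>card (part p)\<close> is kept so that three parts can be compared later.\<close>

lemma card_nb_le:
  assumes v: "v \<in> V" and p: "p \<in> nb k v"
  shows "card (nb k v) \<le> card (part p) + 2 * max_order (m - 2)"
proof -
  let ?U = "\<lambda>l. nb k v \<inter> nb l p"
  have "ord_bound c (?U l) (m - 1 - 1)" for l
    by (rule ord_bound_step[OF nb_bound[OF v] p, where k = l]) auto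
  then have U: "card (?U l) \<le> max_order (m - 2)" for l
    using m_ge_3 by (intro card_le) (auto simp: numeral_eq_Suc)
  have "nb k v \<subseteq> part p \<union> (?U r \<union> ?U b)"
  proof
    fix u assume u: "u \<in> nb k v"
    then show "u \<in> part p \<union> (?U r \<union> ?U b)"
      using cross_color[of p u] p by (cases "f u = f p") auto
  qed
  then have "card (nb k v) \<le> card (part p \<union> (?U r \<union> ?U b))"
    using fin by (intro card_mono) auto
  moreover have "card (part p \<union> (?U r \<union> ?U b)) \<le> card (part p) + card (?U r \<union> ?U b)"
    by (rule card_Un_le)
  moreover have "card (?U r \<union> ?U b) \<le> card (?U r) + card (?U b)" by (rule card_Un_le)
  ultimately show ?thesis using U[of r] U[of b] by linarith
qed

lemma card_le_large_part:
  assumes v: "v \<in> V" and large: "\<not> ord_bound c (part v) (m - 3)"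
  shows "card V \<le> 5 * max_order (m - 2)"
proof -
  interpret swapped: gallai_parts c V f b r m by (rule swap_colors)
  have "card (part v) \<le> max_order (m - 2)"
    using m_ge_3 by (intro card_le part_bound v) auto
  then show ?thesis
    using card_split[OF v] card_nb_le_large_part[OF v large]
      swapped.card_nb_le_large_part[OF v large] by linarith
qed

text \<open>If the graph is too large, then any part together with one \<open>r\<close>-neighboring and one
  \<open>b\<close>-neighboring part has more than \<open>max_order (m - 2)\<close> vertices, so two parts cannot both be
  that short.\<close>

lemma ex_exceptional_part:
  assumes small: "\<And>v. v \<in> V \<Longrightarrow> ord_bound c (part v) (m - 3)"
    and m: "even m" and large: "card V > 5 * max_order (m - 2)"
  shows "\<exists>a\<in>V. \<forall>u\<in>V. f u \<noteq> f a \<longrightarrow> \<not> ord_bound c (part u) (m - 4)"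
proof -
  have m4: "m \<ge> 4" using m_ge_3 m by (cases "m = 3") simp_all
  let ?h = "max_order (m - 2)"
  have h3: "2 * max_order (m - 3) = ?h"
    using max_order_pos_even[of "m - 2"] m4 m by simp
  have h4: "5 * max_order (m - 4) \<le> ?h"
    using max_order_diff_2_le[of "m - 2"] m4 by simp
  have part3: "2 * card (part v) \<le> ?h" if "v \<in> V" for v
    using card_le[of "m - 3" "part v"] small[OF that] m4 h3 by auto
  have part4: "5 * card (part v) \<le> ?h" if "v \<in> V" "ord_bound c (part v) (m - 4)" for v
    using card_le[of "m - 4" "part v"] that m4 h4 by auto
  \<comment> \<open>The two neighborhoods use up \<open>4 * ?h\<close> apart from the two parts, so
    more than \<open>?h\<close> is left for the three parts.\<close>
  have triple: "card (part a) + card (part p) + card (part q) > ?h"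
    if "a \<in> V" "p \<in> nb r a" "q \<in> nb b a" for a p q
    using card_split[of a] card_nb_le[of a p r] card_nb_le[of a q b] that large by linarith
  obtain v0 where v0: "v0 \<in> V" using gallai_partition_nontrivial[OF gallai] by blast
  show ?thesis
  proof (cases "\<exists>a\<in>V. ord_bound c (part a) (m - 4)")
    case False
    then show ?thesis using v0 by blast
  next
    case True
    then obtain a where a: "a \<in> V" "ord_bound c (part a) (m - 4)" by blast
    obtain p q where pq: "p \<in> nb r a" "q \<in> nb b a"
      using r_neighbor[OF a(1)] b_neighbor[OF a(1)] by blast
    have "\<not> ord_bound c (part u) (m - 4)" if u: "u \<in> V" "f u \<noteq> f a" for u
    proof
      assume "ord_bound c (part u) (m - 4)"
      then have "5 * card (part u) \<le> ?h" "5 * card (part a) \<le> ?h" using part4 u a by blast+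
      moreover have "u \<in> nb r a \<or> u \<in> nb b a" using cross_color[OF a(1) u(1)] u by auto
      then have "card (part a) + card (part u) + card (part q) > ?h \<or>
          card (part a) + card (part p) + card (part u) > ?h"
        using triple a pq by blast
      \<comment> \<open>The three parts would have at most (1/5 + 1/5 + 1/2) times \<open>?h\<close>
        vertices, contrary to \<open>triple\<close>.\<close>
      moreover have "2 * card (part p) \<le> ?h" "2 * card (part q) \<le> ?h"
        using part3 pq by blast+
      ultimately show False by linarith
    qed
    then show ?thesis using a by blast
  qed
qed

text \<open>The last two entries of an ordered list of representatives can be exchanged, so the last one
  may be taken outside the exceptional part.\<close>

lemma number_of_parts:
  assumes a: "a \<in> V" "\<And>u. u \<in> V \<Longrightarrow> f u \<noteq> f a \<Longrightarrow> \<not> ord_bound c (part u) (m - 4)"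
  shows "card (f ` V) \<le> 10"
proof (rule ccontr)
  assume "\<not> card (f ` V) \<le> 10"
  then obtain I where I: "I \<subseteq> f ` V" "card I = 11"
    using obtain_subset_with_card_n[of 11 "f ` V"] by auto
  obtain T where T: "T \<subseteq> V" "I = f ` T" "inj_on f T"
    using I(1) by (metis subset_image_inj)
  have cT: "card T = 11" using T I card_image by metis
  have finT: "finite T" using T fin finite_subset by blast
  have colT: "c x y = r \<or> c x y = b" if "x \<in> T" "y \<in> T" "x \<noteq> y" for x y
    using that T cross_color[of x y] by (auto dest: inj_onD)
  obtain v1 v2 v3 v4 v5 where v: "{v1, v2, v3, v4, v5} \<subseteq> T" "ord_list c [v1, v2, v3, v4, v5]"
    using two_colored_ord_list_5[OF finT cT colT] by blast
  then have v': "ord_list c [v1, v2, v3, v5, v4]" by (auto simp: sym)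
  have "f v4 \<noteq> f v5" using T(3) v by (auto dest: inj_onD)
  then obtain x y where xy: "ord_list c ([v1, v2, v3, x] @ [y])" "f y \<noteq> f a" "{v1, v2, v3, x, y} \<subseteq> T"
    using v v' by (cases "f v5 = f a") fastforce+
  then have d: "v1 \<noteq> y" "v2 \<noteq> y" "v3 \<noteq> y" "x \<noteq> y" by auto
  have "ord_bound c (part y) (m - length [v1, v2, v3, x])"
  proof (rule part_bound_append[OF xy(1)])
    show "f z \<noteq> f y" if "z \<in> set [v1, v2, v3, x]" for z
      using that xy(3) d T(3) by (auto dest: inj_onD)
  qed (use xy T in auto)
  then show False using a xy T by (auto simp: numeral_eq_Suc)
qed

lemma card_le_even:
  assumes m: "even m"
  shows "card V \<le> 5 * max_order (m - 2)"
proof (cases "\<exists>v\<in>V. \<not> ord_bound c (part v) (m - 3)")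
  case True
  then show ?thesis using card_le_large_part by blast
next
  case False
  then have small: "ord_bound c (part v) (m - 3)" if "v \<in> V" for v using that by blast
  have m4: "m \<ge> 4" using m_ge_3 m by (cases "m = 3") simp_all
  have h3: "2 * max_order (m - 3) = max_order (m - 2)"
    using max_order_pos_even[of "m - 2"] m4 m by simp
  show ?thesis
  proof (rule ccontr)
    assume large: "\<not> ?thesis"
    then obtain a where "a \<in> V" "\<forall>u\<in>V. f u \<noteq> f a \<longrightarrow> \<not> ord_bound c (part u) (m - 4)"
      using ex_exceptional_part[OF small m] by auto
    then have parts: "card (f ` V) \<le> 10" using number_of_parts by blast
    \<comment> \<open>There are at most 10 parts, each with at most half of
      \<open>max_order (m - 2)\<close> vertices.\<close>
    have "V = (\<Union>i\<in>f ` V. {u \<in> V. f u = i})" by blast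
    then have "card V \<le> (\<Sum>i\<in>f ` V. card {u \<in> V. f u = i})"
      using card_UN_le[of "f ` V" "\<lambda>i. {u \<in> V. f u = i}"] fin by simp
    also have "\<dots> \<le> (\<Sum>i\<in>f ` V. max_order (m - 3))"
      using small m4 by (intro sum_mono) (auto intro!: card_le)
    also have "\<dots> \<le> 10 * max_order (m - 3)" using parts by simp
    also have "\<dots> = 5 * max_order (m - 2)" using h3 by simp
    finally show False using large by simp
  qed
qed

end

lemma (in sym_coloring) card_le_max_order:
  assumes "finite V" "rainbow_free c V" "ord_bound c V m"
  shows "card V \<le> max_order m"
  using assms
proof (induction m arbitrary: V rule: less_induct)
  case (less m)
  have le: "card U \<le> max_order k" if "k < m" "U \<subseteq> V" "ord_bound c U k" for k U
    using less that rainbow_free_subset finite_subset by metis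
  have nonempty: "m \<ge> 1" if V: "V \<noteq> {}"
  proof -
    obtain v where "v \<in> V" using V by blast
    then have "length [v] \<le> m" by (intro ord_boundD[OF less.prems(3)]) auto
    then show ?thesis by simp
  qed
  consider "V = {}" | "card V = 1" | "card V \<ge> 2" using less.prems(1) by (cases "card V") fastforce+
  then show ?case
  proof cases
    case 1
    then show ?thesis by simp
  next
    case 2
    then have "V \<noteq> {}" by force
    then have "m \<ge> 1" by (rule nonempty)
    then show ?thesis using 2 max_order_pos[of m] by linarith
  next
    case 3
    show ?thesis
    \<comment> \<open>If a cut has a single color, a vertex of either side precedes ordered lists of
      the other. Both sides then obey the bound for \<open>m - 1\<close>, and two copies of it fit
      into \<open>max_order m\<close>.\<close>
    proof (cases "\<exists>X k. X \<subseteq> V \<and> X \<noteq> {} \<and> X \<noteq> V \<and> (\<forall>x\<in>X. \<forall>y\<in>V - X. c x y = k)")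
      case True
      then obtain X k where X: "X \<subseteq> V" "X \<noteq> {}" "X \<noteq> V"
        and k: "\<And>x y. x \<in> X \<Longrightarrow> y \<in> V - X \<Longrightarrow> c x y = k" by blast
      obtain x y where xy: "x \<in> X" "y \<in> V - X" using X by blast
      have m: "m \<ge> 1" using nonempty X by blast
      have "ord_bound c X (m - 1)"
        using X xy k by (intro ord_bound_step[OF less.prems(3), where v = y and k = k]) (auto simp: sym[of y])
      then have "card X \<le> max_order (m - 1)" using X m by (intro le) auto
      moreover have "ord_bound c (V - X) (m - 1)"
        using X xy k by (intro ord_bound_step[OF less.prems(3), where v = x and k = k]) auto
      then have "card (V - X) \<le> max_order (m - 1)" using m by (intro le) auto
      moreover have "card V = card X + card (V - X)"
        using X less.prems(1) by (metis card_Diff_subset card_mono finite_subset le_add_diff_inverse)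
      moreover have "m \<noteq> 1"
      proof
        assume "m = 1"
        then have "card X \<le> 0" using \<open>card X \<le> max_order (m - 1)\<close> by simp
        then show False using X less.prems(1) finite_subset by fastforce
      qed
      then have "2 * max_order (m - 1) \<le> max_order m" using max_order_Suc_ge[of "m - 1"] m by simp
      ultimately show ?thesis by linarith
    next
      case False
      then have no_cut: "\<exists>x\<in>X. \<exists>y\<in>V - X. c x y \<noteq> k" if "X \<subseteq> V" "X \<noteq> {}" "X \<noteq> V" for X k
        using that by blast
      obtain f :: "'a \<Rightarrow> 'a set" and r b where part: "gallai_partition c V f r b"
        using ex_gallai_partition 3 less.prems by blast
      note ne = gallai_partition_nontrivial[OF part]
        and col = gallai_partition_color[OF part]
        and unif = gallai_partition_uniform[OF part]
      \<comment> \<open>Otherwise the part of \<open>v\<close> would be one side of a cut in color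
        \<open>k\<close>; uniformity moves the edge found to \<open>v\<close>.\<close>
      have other: "\<exists>u\<in>V. f u \<noteq> f v \<and> c v u \<noteq> k" if v: "v \<in> V" for v k
      proof -
        have "\<exists>u\<in>V. f u \<noteq> f v" using ne by metis
        then have "{u \<in> V. f u = f v} \<noteq> V" by blast
        then obtain x y where "x \<in> V" "f x = f v" "y \<in> V" "f y \<noteq> f v" "c x y \<noteq> k"
          using no_cut[of "{u \<in> V. f u = f v}" k] v by blast
        then show ?thesis using unif[of x v y] v by metis
      qed
      interpret gallai_parts c V f r b m
      proof
        show "\<exists>u\<in>V. f u \<noteq> f v \<and> c v u = r" if "v \<in> V" for v
          using other[OF that, of b] col that by metis
        show "\<exists>u\<in>V. f u \<noteq> f v \<and> c v u = b" if "v \<in> V" for v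
          using other[OF that, of r] col that by metis
        show "r \<noteq> b" using ne other[of _ b] col by metis
      qed (use less.prems part le in auto)
      show ?thesis
      proof (cases "even m")
        case True
        then show ?thesis using card_le_even max_order_diff_2 m_ge_3 by simp
      qed (rule card_le_odd)
    qed
  qed
qed

subsection \<open>The lower bound\<close>

text \<open>On distinct residues mod 5, color 0 is a 5-cycle and color 1 its complement, again a
  5-cycle.\<close>

definition pentagon :: "nat \<Rightarrow> nat \<Rightarrow> nat" where
  "pentagon x y = (if (x + 1) mod 5 = y \<or> (y + 1) mod 5 = x then 0 else 1)"

text \<open>Vertex \<open>x\<close> sits in copy \<open>x mod 5\<close> at position
  \<open>x div 5\<close>. The shift by 2 separates the colors of \<open>c\<close> from the pentagon
  colors 0 and 1.\<close>

definition pentagon_product :: "(nat \<Rightarrow> nat \<Rightarrow> nat) \<Rightarrow> nat \<Rightarrow> nat \<Rightarrow> nat" where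
  "pentagon_product c x y =
     (if x mod 5 = y mod 5 then c (x div 5) (y div 5) + 2 else pentagon (x mod 5) (y mod 5))"

lemma pentagon_le_1: "pentagon x y \<le> 1"
  by (simp add: pentagon_def)

lemma pentagon_sym: "pentagon x y = pentagon y x"
  by (auto simp: pentagon_def)

lemma pentagon_neighbor:
  assumes "v < 5" "w < 5" "v \<noteq> w" "pentagon v w = k"
  shows "k = 0 \<and> (w = (v + 1) mod 5 \<or> w = (v + 4) mod 5) \<or>
    k = 1 \<and> (w = (v + 2) mod 5 \<or> w = (v + 3) mod 5)"
proof -
  have "v \<in> {0, 1, 2, 3, 4}" "w \<in> {0, 1, 2, 3, 4}" using assms(1,2) by auto
  then show ?thesis using assms(3,4) by (auto simp: pentagon_def)
qed

text \<open>Each vertex has two neighbors per color, and \<open>u\<close> is one of them.\<close>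

lemma pentagon_neighbor_unique:
  assumes "u < 5" "v < 5" "w < 5" "w' < 5" "u \<noteq> v" "v \<noteq> w" "v \<noteq> w'" "u \<noteq> w" "u \<noteq> w'"
    and "pentagon v u = k" "pentagon v w = k" "pentagon v w' = k"
  shows "w = w'"
proof -
  note nb = pentagon_neighbor[OF assms(2)]
  show ?thesis
    using nb[OF assms(1) assms(5)[symmetric] assms(10)] nb[OF assms(3,6,11)]
      nb[OF assms(4,7,12)] assms(8,9) by (metis zero_neq_one)
qed

lemma pentagon_product_sym:
  "(\<And>x y. c x y = c y x) \<Longrightarrow> pentagon_product c x y = pentagon_product c y x"
  by (simp add: pentagon_product_def pentagon_sym)

lemma pentagon_product_ge_2_iff: "pentagon_product c x y \<ge> 2 \<longleftrightarrow> x mod 5 = y mod 5"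
  using pentagon_le_1[of "x mod 5" "y mod 5"] by (auto simp: pentagon_product_def)

text \<open>Inside a copy this is a triangle of \<open>c\<close>. If exactly two vertices share a
  copy, their edges to the third agree. Across three copies only two colors occur.\<close>

lemma rainbow_free_pentagon_product:
  assumes sym: "\<And>x y. c x y = c y x" and rf: "rainbow_free c {..<n}"
  shows "rainbow_free (pentagon_product c) {..<5 * n}"
  unfolding rainbow_free_def
proof (intro ballI impI)
  fix x y z assume xyz: "x \<in> {..<5 * n}" "y \<in> {..<5 * n}" "z \<in> {..<5 * n}"
    and neq: "x \<noteq> y" "y \<noteq> z" "x \<noteq> z"
  let ?d = "pentagon_product c"
  show "?d x y = ?d x z \<or> ?d x y = ?d y z \<or> ?d x z = ?d y z"
  proof (cases "x mod 5 = y mod 5 \<and> y mod 5 = z mod 5")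
    case True
    then have "x div 5 \<noteq> y div 5" "y div 5 \<noteq> z div 5" "x div 5 \<noteq> z div 5"
      using neq by (metis div_mult_mod_eq)+
    moreover have "x div 5 < n" "y div 5 < n" "z div 5 < n" using xyz by auto
    ultimately have "c (x div 5) (y div 5) = c (x div 5) (z div 5) \<or>
        c (x div 5) (y div 5) = c (y div 5) (z div 5) \<or> c (x div 5) (z div 5) = c (y div 5) (z div 5)"
      using rf unfolding rainbow_free_def by blast
    then show ?thesis using True by (simp add: pentagon_product_def)
  next
    case False
    then consider "x mod 5 = y mod 5" "y mod 5 \<noteq> z mod 5" | "y mod 5 = z mod 5" "x mod 5 \<noteq> y mod 5"
      | "x mod 5 = z mod 5" "x mod 5 \<noteq> y mod 5"
      | "x mod 5 \<noteq> y mod 5" "y mod 5 \<noteq> z mod 5" "x mod 5 \<noteq> z mod 5" by metis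
    then show ?thesis
    proof cases
      case 3
      then show ?thesis by (simp add: pentagon_product_def pentagon_sym)
    next
      case 4
      then show ?thesis
        using pentagon_le_1[of "x mod 5" "y mod 5"] pentagon_le_1[of "x mod 5" "z mod 5"]
          pentagon_le_1[of "y mod 5" "z mod 5"] by (simp add: pentagon_product_def) linarith
    qed (simp_all add: pentagon_product_def)
  qed
qed

text \<open>If one of the first two entries sends a color of at least 2, the list from there on
  stays in one copy. Otherwise \<open>v\<close> sends a pentagon color \<open>k\<close> to
  \<open>u\<close> and to the tail, which avoids the copy of \<open>u\<close>; so the tail lies in
  the copy of the other \<open>k\<close>-neighbor.\<close>

lemma ord_bound_pentagon_product:
  assumes bound: "ord_bound c {..<n} m"
  shows "ord_bound (pentagon_product c) {..<5 * n} (m + 2)"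
  unfolding ord_bound_def
proof (intro allI impI)
  let ?d = "pentagon_product c"
  have inner: "length vs \<le> m" if vs: "ord_list ?d vs" "set vs \<subseteq> {..<5 * n}"
    and res: "\<And>x. x \<in> set vs \<Longrightarrow> x mod 5 = r" for vs r
  proof -
    have "inj_on (\<lambda>x. x div 5) (set vs)"
      using res by (intro inj_onI) (metis div_mult_mod_eq)
    \<comment> \<open>Subtracting 2 undoes the color shift.\<close>
    then have "ord_list c (map (\<lambda>x. x div 5) vs)"
      using vs(1) res by (intro ord_list_map[where g = "\<lambda>k. k - 2" and c = ?d])
        (auto simp: pentagon_product_def)
    moreover have "set (map (\<lambda>x. x div 5) vs) \<subseteq> {..<n}" using vs(2) by auto
    ultimately have "length (map (\<lambda>x. x div 5) vs) \<le> m" by (rule ord_boundD[OF bound])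
    then show ?thesis by simp
  qed
  fix vs assume vs: "ord_list ?d vs" "set vs \<subseteq> {..<5 * n}"
  show "length vs \<le> m + 2"
  proof (cases vs)
    case Nil
    then show ?thesis by simp
  next
    case (Cons v us)
    then obtain k where k: "\<And>u. u \<in> set us \<Longrightarrow> ?d v u = k" using vs by auto
    show ?thesis
    proof (cases us)
      case Nil
      then show ?thesis using Cons by simp
    next
      case us: (Cons u ws)
      then obtain l where l: "\<And>w. w \<in> set ws \<Longrightarrow> ?d u w = l" using vs Cons by auto
      have ou: "ord_list ?d (u # ws)" "ord_list ?d ws" using vs(1) Cons us by auto
      have sub: "set (u # ws) \<subseteq> {..<5 * n}" "set ws \<subseteq> {..<5 * n}" using vs(2) Cons us by simp_all
      show ?thesis
      proof (cases "k \<ge> 2")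
        case True
        then have "x mod 5 = v mod 5" if "x \<in> set vs" for x
          using that Cons k pentagon_product_ge_2_iff[of c v x] by auto
        then have "length vs \<le> m" by (rule inner[OF vs])
        then show ?thesis by simp
      next
        case k2: False
        show ?thesis
        proof (cases "l \<ge> 2")
          case True
          then have res: "x mod 5 = u mod 5" if "x \<in> set (u # ws)" for x
            using that l pentagon_product_ge_2_iff[of c u x] by auto
          have "length (u # ws) \<le> m" by (rule inner[OF ou(1) sub(1) res])
          then show ?thesis using Cons us by simp
        next
          case l2: False
          have vu: "v mod 5 \<noteq> u mod 5" using k[of u] k2 us pentagon_product_ge_2_iff[of c v u] by auto
          have vw: "v mod 5 \<noteq> w mod 5" if "w \<in> set ws" for w
            using k[of w] that k2 us pentagon_product_ge_2_iff[of c v w] by auto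
          have uw: "u mod 5 \<noteq> w mod 5" if "w \<in> set ws" for w
            using l[of w] that l2 pentagon_product_ge_2_iff[of c u w] by auto
          have pv: "pentagon (v mod 5) (w mod 5) = k" if "w \<in> set (u # ws)" for w
            using k[of w] that us vu vw by (auto simp: pentagon_product_def)
          \<comment> \<open>\<open>hd ws\<close> only serves to name the common copy.\<close>
          have res: "w mod 5 = hd ws mod 5" if "w \<in> set ws" for w
          proof -
            have h: "hd ws \<in> set ws" using that by (cases ws) auto
            have p: "pentagon (v mod 5) (u mod 5) = k" "pentagon (v mod 5) (w mod 5) = k"
              "pentagon (v mod 5) (hd ws mod 5) = k" using pv that h by simp_all
            show ?thesis
              by (rule pentagon_neighbor_unique[OF _ _ _ _ vu[symmetric] vw[OF that] vw[OF h]
                uw[OF that] uw[OF h] p]) simp_all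
          qed
          have "length ws \<le> m" by (rule inner[OF ou(2) sub(2) res])
          then show ?thesis using Cons us by simp
        qed
      qed
    qed
  qed
qed

lemma rainbow_free_card_le_2: "finite V \<Longrightarrow> card V \<le> 2 \<Longrightarrow> rainbow_free c V"
  unfolding rainbow_free_def
proof (intro ballI impI)
  fix x y z assume "finite V" "card V \<le> 2" "x \<in> V" "y \<in> V" "z \<in> V" "x \<noteq> y" "y \<noteq> z" "x \<noteq> z"
  then have "card {x, y, z} \<le> 2" by (meson card_mono empty_subsetI insert_subset order_trans)
  then show "c x y = c x z \<or> c x y = c y z \<or> c x z = c y z"
    using \<open>x \<noteq> y\<close> \<open>y \<noteq> z\<close> \<open>x \<noteq> z\<close> by simp
qed

lemma ex_extremal_coloring:
  "\<exists>c :: nat \<Rightarrow> nat \<Rightarrow> nat. (\<forall>x y. c x y = c y x) \<and>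
     rainbow_free c {..<max_order m} \<and> ord_bound c {..<max_order m} m"
  (is "?P m")
proof -
  \<comment> \<open>With at most two vertices a constant coloring has no triangle, and no list is
    longer than the vertex set is large.\<close>
  have base: "?P m" if m: "max_order m = m" "m \<le> 2" for m
  proof (intro exI conjI)
    show "rainbow_free (\<lambda>_ _. 0 :: nat) {..<max_order m}"
      using m by (intro rainbow_free_card_le_2) simp_all
    show "ord_bound (\<lambda>_ _. 0 :: nat) {..<max_order m} m"
      using ord_bound_card[of "{..<m}"] m(1) by simp
  qed simp
  show ?thesis
  proof (induction m rule: max_order.induct)
    case 1
    show ?case by (rule base) simp_all
  next
    case 2
    show ?case by (rule base) simp_all
  next
    case 3
    show ?case by (rule base) simp_all
  next
    case (4 m)
    then obtain c :: "nat \<Rightarrow> nat \<Rightarrow> nat" where "\<And>x y. c x y = c y x"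
      "rainbow_free c {..<max_order (Suc m)}" "ord_bound c {..<max_order (Suc m)} (Suc m)" by blast
    then show ?case
      using rainbow_free_pentagon_product[of c] ord_bound_pentagon_product[of c _ "Suc m"]
      by (intro exI[of _ "pentagon_product c"]) (simp add: pentagon_product_sym[of c])
  qed
qed

section \<open>From ordered lists to \<open>orderable\<close>, \<open>rainbow\<close> and the value
  of \<open>CR\<close>\<close>

lemma orderable_complete_iff:
  fixes \<chi> :: "'a set \<Rightarrow> 'c"
  shows "orderable S (nsets S 2) \<chi> \<longleftrightarrow> (\<exists>vs. set vs = S \<and> ord_list (\<lambda>x y. \<chi> {x, y}) vs)"
proof
  assume "orderable S (nsets S 2) \<chi>"
  then obtain vs cs where vs: "set vs = S" "distinct vs"
    and cs: "\<And>i j. i < j \<Longrightarrow> j < length vs \<Longrightarrow> {vs ! i, vs ! j} \<in> nsets S 2 \<Longrightarrow>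
      \<chi> {vs ! i, vs ! j} = cs ! i"
    unfolding orderable_def by blast
  have "\<chi> {vs ! i, vs ! j} = cs ! i" if "i < j" "j < length vs" for i j
  proof -
    have "vs ! i \<noteq> vs ! j" "vs ! i \<in> S" "vs ! j \<in> S" using vs that by (auto simp: nth_eq_iff_index_eq)
    then show ?thesis using cs that by simp
  qed
  then show "\<exists>vs. set vs = S \<and> ord_list (\<lambda>x y. \<chi> {x, y}) vs"
    using vs by (auto simp: ord_list_iff_nth)
next
  assume "\<exists>vs. set vs = S \<and> ord_list (\<lambda>x y. \<chi> {x, y}) vs"
  then obtain vs and g :: "nat \<Rightarrow> 'c" where "set vs = S" "distinct vs"
    and "\<forall>j<length vs. \<forall>i<j. \<chi> {vs ! i, vs ! j} = g i"
    by (auto simp: ord_list_iff_nth)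
  then show "orderable S (nsets S 2) \<chi>"
    unfolding orderable_def by (intro exI[of _ vs] exI[of _ "map g [0..<length vs - 1]"]) auto
qed

lemma ex_orderable_iff:
  assumes "s \<ge> 1"
  shows "(\<exists>S\<subseteq>V. card S = s \<and> orderable S (nsets S 2) \<chi>) \<longleftrightarrow>
    \<not> ord_bound (\<lambda>x y. \<chi> {x, y}) V (s - 1)"
proof
  assume "\<exists>S\<subseteq>V. card S = s \<and> orderable S (nsets S 2) \<chi>"
  then obtain vs where "set vs \<subseteq> V" "card (set vs) = s" "ord_list (\<lambda>x y. \<chi> {x, y}) vs"
    by (auto simp: orderable_complete_iff)
  moreover from this have "length vs = s" using distinct_card ord_list_distinct by metis
  ultimately show "\<not> ord_bound (\<lambda>x y. \<chi> {x, y}) V (s - 1)"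
    using assms ord_boundD by fastforce
next
  assume "\<not> ord_bound (\<lambda>x y. \<chi> {x, y}) V (s - 1)"
  then obtain vs where vs: "ord_list (\<lambda>x y. \<chi> {x, y}) vs" "set vs \<subseteq> V" "length vs \<ge> s"
    unfolding ord_bound_def by force
  \<comment> \<open>Suffixes stay ordered, so a longer list is cut to exactly \<open>s\<close>
    entries.\<close>
  let ?ws = "drop (length vs - s) vs"
  have ws: "ord_list (\<lambda>x y. \<chi> {x, y}) ?ws" using vs(1) by (rule ord_list_drop)
  then have "card (set ?ws) = s" using vs(3) by (simp add: distinct_card ord_list_distinct)
  moreover have "set ?ws \<subseteq> V" using vs(2) set_drop_subset by fast
  ultimately show "\<exists>S\<subseteq>V. card S = s \<and> orderable S (nsets S 2) \<chi>"
    using ws orderable_complete_iff by metis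
qed

lemma ex_rainbow_triangle_iff:
  "(\<exists>T\<subseteq>V. card T = 3 \<and> rainbow (nsets T 2) \<chi>) \<longleftrightarrow> \<not> rainbow_free (\<lambda>x y. \<chi> {x, y}) V"
proof
  assume "\<exists>T\<subseteq>V. card T = 3 \<and> rainbow (nsets T 2) \<chi>"
  then obtain x y z where T: "{x, y, z} \<subseteq> V" "x \<noteq> y" "y \<noteq> z" "x \<noteq> z"
    and rb: "rainbow (nsets {x, y, z} 2) \<chi>" by (metis card_3_iff)
  have e: "{x, y} \<in> nsets {x, y, z} 2" "{x, z} \<in> nsets {x, y, z} 2" "{y, z} \<in> nsets {x, y, z} 2"
    using T by auto
  have d: "{x, y} \<noteq> {x, z}" "{x, y} \<noteq> {y, z}" "{x, z} \<noteq> {y, z}"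
    using T by (auto simp: doubleton_eq_iff)
  note colors = rb[unfolded rainbow_def, rule_format]
  have "\<chi> {x, y} \<noteq> \<chi> {x, z}" "\<chi> {x, y} \<noteq> \<chi> {y, z}" "\<chi> {x, z} \<noteq> \<chi> {y, z}"
    by (rule colors[OF e(1,2) d(1)] colors[OF e(1,3) d(2)] colors[OF e(2,3) d(3)])+
  then show "\<not> rainbow_free (\<lambda>x y. \<chi> {x, y}) V"
    using T unfolding rainbow_free_def by (meson insert_subset)
next
  assume "\<not> rainbow_free (\<lambda>x y. \<chi> {x, y}) V"
  then obtain x y z where T: "{x, y, z} \<subseteq> V" "x \<noteq> y" "y \<noteq> z" "x \<noteq> z"
    and c: "\<chi> {x, y} \<noteq> \<chi> {x, z}" "\<chi> {x, y} \<noteq> \<chi> {y, z}" "\<chi> {x, z} \<noteq> \<chi> {y, z}"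
    unfolding rainbow_free_def by auto
  have "e = {x, y} \<or> e = {x, z} \<or> e = {y, z}" if "e \<in> nsets {x, y, z} 2" for e
    using that unfolding nsets_def card_2_iff by auto
  then have "rainbow (nsets {x, y, z} 2) \<chi>"
    using c unfolding rainbow_def by metis
  moreover have "card {x, y, z} = 3" using T by simp
  ultimately show "\<exists>T\<subseteq>V. card T = 3 \<and> rainbow (nsets T 2) \<chi>" using T by blast
qed

lemma forces_iff:
  assumes "s \<ge> 1"
  shows "forces s 3 n \<longleftrightarrow> (\<nexists>\<chi> :: nat set \<Rightarrow> nat.
    ord_bound (\<lambda>x y. \<chi> {x, y}) {..<n} (s - 1) \<and> rainbow_free (\<lambda>x y. \<chi> {x, y}) {..<n})"
  unfolding forces_def ex_orderable_iff[OF assms] ex_rainbow_triangle_iff by blast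

lemma CR_3_eq_max_order:
  assumes "s \<ge> 1"
  shows "CR s 3 = max_order (s - 1) + 1"
proof -
  have forces: "forces s 3 (max_order (s - 1) + 1)"
    unfolding forces_iff[OF assms]
  proof (rule notI, elim exE conjE)
    fix \<chi> :: "nat set \<Rightarrow> nat"
    assume \<chi>: "ord_bound (\<lambda>x y. \<chi> {x, y}) {..<max_order (s - 1) + 1} (s - 1)"
      "rainbow_free (\<lambda>x y. \<chi> {x, y}) {..<max_order (s - 1) + 1}"
    interpret sym_coloring "\<lambda>x y. \<chi> {x, y}"
      by unfold_locales (simp add: insert_commute)
    show False using card_le_max_order[OF _ \<chi>(2,1)] by simp
  qed
  have "n \<ge> max_order (s - 1) + 1" if n: "forces s 3 n" for n
  proof (rule ccontr)
    assume "\<not> n \<ge> max_order (s - 1) + 1"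
    then have sub: "{..<n} \<subseteq> {..<max_order (s - 1)}" by auto
    obtain c :: "nat \<Rightarrow> nat \<Rightarrow> nat" where c: "\<And>x y. c x y = c y x"
      "rainbow_free c {..<max_order (s - 1)}" "ord_bound c {..<max_order (s - 1)} (s - 1)"
      using ex_extremal_coloring by blast
    \<comment> \<open>\<open>Min\<close> and \<open>Max\<close> recover the two ends of an edge;
      symmetry of \<open>c\<close> makes their order irrelevant.\<close>
    define \<chi> where "\<chi> e = c (Min e) (Max e)" for e
    have "(\<lambda>x y. \<chi> {x, y}) = c"
      using c(1) by (auto simp: \<chi>_def fun_eq_iff min_def max_def)
    moreover have "rainbow_free c {..<n}" "ord_bound c {..<n} (s - 1)"
      by (rule rainbow_free_subset[OF c(2) sub] ord_bound_subset[OF c(3) sub])+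
    ultimately show False
      using n unfolding forces_iff[OF assms] by metis
  qed
  then have "(LEAST n. forces s 3 n) = max_order (s - 1) + 1"
    using forces by (intro Least_equality)
  then show ?thesis unfolding CR_def using forces by auto
qed

theorem theorem1p5:
  fixes s :: nat
  assumes "s \<ge> 3"
  shows "CR s 3 = (if odd s then 2 * 5 ^ ((s - 3) div 2) + 1 else 5 ^ ((s - 2) div 2) + 1)"
proof (cases "odd s")
  case True
  then have "s - 1 = 2 * ((s - 3) div 2) + 2" using assms by presburger
  then have "max_order (s - 1) = 2 * 5 ^ ((s - 3) div 2)" by (metis max_order_even)
  then show ?thesis using True CR_3_eq_max_order[of s] assms by simp
next
  case False
  then have "s - 1 = 2 * ((s - 2) div 2) + 1" using assms by presburger
  then have "max_order (s - 1) = 5 ^ ((s - 2) div 2)" by (metis max_order_odd)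
  then show ?thesis using False CR_3_eq_max_order[of s] assms by simp
qed

end
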